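(* For any fixed $\mathbf E\in\{\mathbf E:\mathbf E^-\preceq\mathbf E\preceq\mathbf E^+\}$ and any strain $\varepsilon\in\mathbb S^{2\times2}$ with Frobenius norm $\sqrt2/2$, put $t=|\mathrm{Tr}(\varepsilon)|$. The minimal $v\in[0,1]$ such that the Hashin--Shtrikman upper bound $\langle\mathbf E\varepsilon,\varepsilon\rangle\le f^{HS}(\varepsilon;v)$ is active, i.e. $\langle\mathbf E\varepsilon,\varepsilon\rangle=f^{HS}(\varepsilon;v)$, is given by $$\hat v(\varepsilon;\mathbf E)=\begin{cases}\hat v_1&\text{if }\hat v_1\le\dfrac{\kappa^++\mu^+}{t+\sqrt{1-t^2}}\min\Big\{\dfrac{\sqrt{1-t^2}}{\Delta\kappa},\dfrac{t}{\Delta\mu}\Big\},\\[2mm]\hat v_2&\text{if }\hat v_2>\dfrac{(\kappa^++\mu^+)\sqrt{1-t^2}}{\Delta\kappa(t+\sqrt{1-t^2})},\\[2mm]\hat v_3&\text{if }\hat v_3>\dfrac{(\kappa^++\mu^+)t}{\Delta\mu(t+\sqrt{1-t^2})},\end{cases}$$ where $$\hat v_1=\frac12+\frac{\langle\mathbf E\varepsilon,\varepsilon\rangle(\Delta\mu+\Delta\kappa)+(2t^2-1)(\Delta\kappa\,\mu^+-\Delta\mu\,\kappa^+)-\sqrt D}{2\Delta\mu\Delta\kappa(t+\sqrt{1-t^2})^2},$$ $$\hat v_2=\frac{\kappa^++\mu^+}{\Delta\kappa}\Big[1-\frac{t^2(\kappa^-+\mu^+)}{\langle\mathbf E\varepsilon,\varepsilon\rangle-\mu^+(1-2t^2)}\Big],\qquad\hat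 v_3=\frac{\kappa^++\mu^+}{\Delta\mu}\Big[1-\frac{(1-t^2)(\kappa^++\mu^-)}{\langle\mathbf E\varepsilon,\varepsilon\rangle+\kappa^+(1-2t^2)}\Big],$$ with $$D=\big[\langle\mathbf E\varepsilon,\varepsilon\rangle(\Delta\mu+\Delta\kappa)+(1-2t^2)(\Delta\mu\,\kappa^+-\Delta\kappa\,\mu^+)+\Delta\mu\Delta\kappa(\sqrt{1-t^2}+t)^2\big]^2-4\Delta\mu\Delta\kappa(\kappa^++\mu^+)(\sqrt{1-t^2}+t)^2\big(\langle\mathbf E\varepsilon,\varepsilon\rangle+(t^2-1)\mu^--t^2\kappa^-\big).$$
   Context: $\mathbb S^{2\times2}$ is the space of real symmetric $2\times2$ matrices with the Frobenius inner product $\langle\cdot,\cdot\rangle$; elasticity tensors $\mathbf E$ are fourth-order tensors acting as self-adjoint linear maps on $\mathbb S^{2\times2}$; $\preceq$ is the Loewner order. The two isotropic phases are $\mathbf E^\pm\varepsilon=\kappa^\pm\mathrm{Tr}(\varepsilon)I+2\mu^\pm(\varepsilon-\tfrac12\mathrm{Tr}(\varepsilon)I)$ with $0<\kappa^-<\kappa^+$, $0<\mu^-<\mu^+$; $\Delta\kappa=\kappa^+-\kappa^-$, $\Delta\mu=\mu^+-\mu^-$. For $\|\varepsilon\|_F=\sqrt2/2$, $t=|\mathrm{Tr}(\varepsilon)|\in[0,1]$ and $v\in[0,1]$ (volume fraction of the stiff phase $\mathbf E^+$): $f^{HS}(\varepsilon;v)=\langle[(1-v)\mathbf E^-+v\mathbf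 E^+]\varepsilon,\varepsilon\rangle-q(t;v)$ with $q(t;v)=\dfrac{v(1-v)(\Delta\kappa\,t-\Delta\mu\sqrt{1-t^2})^2}{\kappa^++\mu^+-(\Delta\kappa+\Delta\mu)v}$ if $v t\Delta\kappa\le(\kappa^++\mu^+-\Delta\kappa v)\sqrt{1-t^2}$ and $v\Delta\mu\sqrt{1-t^2}\le(\kappa^++\mu^+-\Delta\mu v)t$; $q(t;v)=(1-v)\Big[\dfrac{v t^2\Delta\kappa^2}{\kappa^++\mu^+-\Delta\kappa v}-(1-t^2)\Delta\mu\Big]$ if $v t\Delta\kappa>(\kappa^++\mu^+-\Delta\kappa v)\sqrt{1-t^2}$; $q(t;v)=(1-v)\Big[\dfrac{v\Delta\mu^2(1-t^2)}{\kappa^++\mu^+-\Delta\mu v}-t^2\Delta\kappa\Big]$ if $v\Delta\mu\sqrt{1-t^2}>(\kappa^++\mu^+-\Delta\mu v)t$.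
   Formalization: The second and third cases additionally require v̂₂ ≤ 1 and v̂₃ ≤ 1 respectively; without this the cases can overlap with different values (κ⁻=μ⁻=1, κ⁺=μ⁺=2, t=1/10, ⟨Eε,ε⟩≈1.4343 gives v̂₂≈4.23 and v̂₃=1/2, both above their thresholds). *)

theory Defs
  imports "HOL-Analysis.Analysis"
begin

text \<open>
  On \<open>real^2^2\<close> the library's inner product and norm are the Frobenius ones.
  The moduli are passed in the order \<open>km kp mm mp\<close>, i.e. kappa-, kappa+, mu-, mu+.
\<close>

definition sym_mats :: "(real^2^2) set" where
  "sym_mats = {A. transpose A = A}"

text \<open>Only the action on symmetric matrices is constrained; values elsewhere are irrelevant.\<close>

definition elasticity_tensor :: "(real^2^2 \<Rightarrow> real^2^2) \<Rightarrow> bool" where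
  "elasticity_tensor E \<longleftrightarrow>
     (\<forall>A\<in>sym_mats. E A \<in> sym_mats) \<and>
     (\<forall>A\<in>sym_mats. \<forall>B\<in>sym_mats. E (A + B) = E A + E B) \<and>
     (\<forall>c. \<forall>A\<in>sym_mats. E (c *\<^sub>R A) = c *\<^sub>R E A) \<and>
     (\<forall>A\<in>sym_mats. \<forall>B\<in>sym_mats. E A \<bullet> B = A \<bullet> E B)"

definition loewner_le :: "(real^2^2 \<Rightarrow> real^2^2) \<Rightarrow> (real^2^2 \<Rightarrow> real^2^2) \<Rightarrow> bool" where
  "loewner_le E F \<longleftrightarrow> (\<forall>A\<in>sym_mats. E A \<bullet> A \<le> F A \<bullet> A)"

definition iso_tensor :: "real \<Rightarrow> real \<Rightarrow> real^2^2 \<Rightarrow> real^2^2" where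
  "iso_tensor \<kappa> \<mu> A =
     (\<kappa> * trace A) *\<^sub>R mat 1 + (2 * \<mu>) *\<^sub>R (A - (trace A / 2) *\<^sub>R mat 1)"

text \<open>
  For \<open>t\<close> and \<open>v\<close> in \<open>[0,1]\<close> exactly one of the three regimes holds: the first one fails
  iff one of its two inequalities does, and both cannot fail at once, as this would force
  \<open>(kp - km) + (mp - mm) > kp + mp\<close>. Hence the nesting order below is immaterial.
\<close>

definition hs_q :: "real \<Rightarrow> real \<Rightarrow> real \<Rightarrow> real \<Rightarrow> real \<Rightarrow> real \<Rightarrow> real" where
  "hs_q km kp mm mp t v =
     (let dk = kp - km; dm = mp - mm; s = sqrt (1 - t\<^sup>2) in
      if v * t * dk \<le> (kp + mp - dk * v) * s \<and> v * dm * s \<le> (kp + mp - dm * v) * t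
      then v * (1 - v) * (dk * t - dm * s)\<^sup>2 / (kp + mp - (dk + dm) * v)
      else if v * t * dk > (kp + mp - dk * v) * s
      then (1 - v) * (v * t\<^sup>2 * dk\<^sup>2 / (kp + mp - dk * v) - (1 - t\<^sup>2) * dm)
      else (1 - v) * (v * dm\<^sup>2 * (1 - t\<^sup>2) / (kp + mp - dm * v) - t\<^sup>2 * dk))"

definition f_HS :: "real \<Rightarrow> real \<Rightarrow> real \<Rightarrow> real \<Rightarrow> real^2^2 \<Rightarrow> real \<Rightarrow> real" where
  "f_HS km kp mm mp A v =
     ((1 - v) *\<^sub>R iso_tensor km mm A + v *\<^sub>R iso_tensor kp mp A) \<bullet> A
       - hs_q km kp mm mp \<bar>trace A\<bar> v"

definition hs_active_set ::
  "real \<Rightarrow> real \<Rightarrow> real \<Rightarrow> real \<Rightarrow> (real^2^2 \<Rightarrow> real^2^2) \<Rightarrow> real^2^2 \<Rightarrow> real set" where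
  "hs_active_set km kp mm mp E A = {v. 0 \<le> v \<and> v \<le> 1 \<and> E A \<bullet> A = f_HS km kp mm mp A v}"

text \<open>Below, \<open>e\<close> stands for the energy \<open>E A \<bullet> A\<close> and \<open>t\<close> for \<open>\<bar>trace A\<bar>\<close>.\<close>

definition vhat_D :: "real \<Rightarrow> real \<Rightarrow> real \<Rightarrow> real \<Rightarrow> real \<Rightarrow> real \<Rightarrow> real" where
  "vhat_D km kp mm mp e t =
     (let dk = kp - km; dm = mp - mm; s = sqrt (1 - t\<^sup>2) in
      (e * (dm + dk) + (1 - 2 * t\<^sup>2) * (dm * kp - dk * mp) + dm * dk * (s + t)\<^sup>2)\<^sup>2
      - 4 * dm * dk * (kp + mp) * (s + t)\<^sup>2 * (e + (t\<^sup>2 - 1) * mm - t\<^sup>2 * km))"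

definition vhat1 :: "real \<Rightarrow> real \<Rightarrow> real \<Rightarrow> real \<Rightarrow> real \<Rightarrow> real \<Rightarrow> real" where
  "vhat1 km kp mm mp e t =
     (let dk = kp - km; dm = mp - mm; s = sqrt (1 - t\<^sup>2) in
      1 / 2 + (e * (dm + dk) + (2 * t\<^sup>2 - 1) * (dk * mp - dm * kp) - sqrt (vhat_D km kp mm mp e t))
              / (2 * dm * dk * (t + s)\<^sup>2))"

text \<open>
  If the inner denominator vanishes, division by zero gives \<open>vhat2 = (kp + mp) / (kp - km) > 1\<close>
  and \<open>vhat3 = (kp + mp) / (mp - mm) > 1\<close>, so neither is then a value in \<open>[0,1]\<close>.
\<close>

definition vhat2 :: "real \<Rightarrow> real \<Rightarrow> real \<Rightarrow> real \<Rightarrow> real \<Rightarrow> real \<Rightarrow> real" where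
  "vhat2 km kp mm mp e t =
     (kp + mp) / (kp - km) * (1 - t\<^sup>2 * (km + mp) / (e - mp * (1 - 2 * t\<^sup>2)))"

definition vhat3 :: "real \<Rightarrow> real \<Rightarrow> real \<Rightarrow> real \<Rightarrow> real \<Rightarrow> real \<Rightarrow> real" where
  "vhat3 km kp mm mp e t =
     (kp + mp) / (mp - mm) * (1 - (1 - t\<^sup>2) * (kp + mm) / (e + kp * (1 - 2 * t\<^sup>2)))"

text \<open>
  The case conditions of the formula for the minimal volume fraction. In the second and third
  case the value is required to be a volume fraction, i.e. at most \<open>1\<close> (nonnegativity follows
  from the lower bound). The inequality \<open>vhat2 > ...\<close> alone also holds spuriously, with
  \<open>vhat2 > 1\<close>, whenever \<open>t > 0\<close> and \<open>e \<le> mp * (1 - 2 * t\<^sup>2)\<close>, and similarly for \<open>vhat3\<close>.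
\<close>

definition vhat_case1 :: "real \<Rightarrow> real \<Rightarrow> real \<Rightarrow> real \<Rightarrow> real \<Rightarrow> real \<Rightarrow> bool" where
  "vhat_case1 km kp mm mp e t \<longleftrightarrow>
     (let s = sqrt (1 - t\<^sup>2) in
      vhat1 km kp mm mp e t \<le> (kp + mp) / (t + s) * min (s / (kp - km)) (t / (mp - mm)))"

definition vhat_case2 :: "real \<Rightarrow> real \<Rightarrow> real \<Rightarrow> real \<Rightarrow> real \<Rightarrow> real \<Rightarrow> bool" where
  "vhat_case2 km kp mm mp e t \<longleftrightarrow>
     (let s = sqrt (1 - t\<^sup>2) in
      vhat2 km kp mm mp e t > (kp + mp) * s / ((kp - km) * (t + s)) \<and>
      vhat2 km kp mm mp e t \<le> 1)"

definition vhat_case3 :: "real \<Rightarrow> real \<Rightarrow> real \<Rightarrow> real \<Rightarrow> real \<Rightarrow> real \<Rightarrow> bool" where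
  "vhat_case3 km kp mm mp e t \<longleftrightarrow>
     (let s = sqrt (1 - t\<^sup>2) in
      vhat3 km kp mm mp e t > (kp + mp) * t / ((mp - mm) * (t + s)) \<and>
      vhat3 km kp mm mp e t \<le> 1)"

end

theory Submission
  imports Defs
begin

text \<open>
  Write \<open>s = sqrt (1 - t\<^sup>2)\<close>. In each of its three regimes the bound, as a function of \<open>v\<close>, is
  strictly increasing on \<open>[0,1]\<close>: the \<open>side\<close> formulas are fractional linear in \<open>v\<close>, and the
  \<open>interior\<close> formula is an increasing linear function plus a nonnegative multiple of \<open>1 / (K - c * v)\<close>, where
  \<open>K = kp + mp\<close> and \<open>c = (kp - km) + (mp - mm)\<close>. Each side formula
  exceeds the interior one by a multiple of a square that vanishes exactly at the regime boundary.
  Hence the whole bound is strictly increasing and the active set has at most one point. The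
  number \<open>vhat1\<close> is the smaller root of a quadratic that is nonnegative at \<open>0\<close> and nonpositive at
  \<open>1\<close>; if it lies beyond a regime boundary, comparing the two formulas there and at \<open>vhat1\<close> forces
  the solution of the side equation to lie between the boundary and \<open>vhat1\<close>. The two side regimes
  are exchanged by swapping bulk and shear moduli together with \<open>t\<close> and \<open>s\<close>.
\<close>

section \<open>The bound as a function of the volume fraction\<close>

text \<open>Having \<open>s\<close> as a second parameter on the unit circle, instead of a square
  root in \<open>t\<close>, makes the setting symmetric: exchanging bulk with shear moduli and
  \<open>t\<close> with \<open>s\<close> gives another instance.\<close>

locale hs_data =
  fixes km kp mm mp t s :: real
  assumes km: "0 < km" and kp: "km < kp" and mm: "0 < mm" and mp: "mm < mp"
    and t: "0 \<le> t" and s: "0 \<le> s" and circle: "t\<^sup>2 + s\<^sup>2 = 1"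
begin

abbreviation "dk \<equiv> kp - km"
abbreviation "dm \<equiv> mp - mm"
abbreviation "K \<equiv> kp + mp"

definition interior :: "real \<Rightarrow> real" where
  "interior v = km * t\<^sup>2 + mm * s\<^sup>2 + v * (dk * t\<^sup>2 + dm * s\<^sup>2)
     - v * (1 - v) * (dk * t - dm * s)\<^sup>2 / (K - (dk + dm) * v)"

text \<open>The second regime of the bound in partial fractions: \<open>v\<close> occurs only in a
  denominator, so the formula is easy to compare and to invert.\<close>

definition side :: "real \<Rightarrow> real" where
  "side v = mp * (s\<^sup>2 - t\<^sup>2) + t\<^sup>2 * K * (km + mp) / (K - dk * v)"

definition beyond :: "real \<Rightarrow> bool" where
  "beyond v \<longleftrightarrow> v * t * dk > (K - dk * v) * s"

section \<open>Symmetry, positive denominators and regime thresholds\<close>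

lemma swap: "hs_data mm mp km kp s t"
  using km kp mm mp t s circle by unfold_locales (auto simp: add.commute)

lemma sqrt_t: "sqrt (1 - t\<^sup>2) = s"
proof -
  have "1 - t\<^sup>2 = s\<^sup>2" using circle by simp
  then show ?thesis using s by simp
qed

lemma ts_pos: "0 < t + s"
proof -
  have "t \<noteq> 0 \<or> s \<noteq> 0" using circle by auto
  then show ?thesis using t s by linarith
qed

lemma denom_int:
  assumes "v \<le> 1" shows "0 < K - (dk + dm) * v"
proof -
  have "(dk + dm) * v \<le> (dk + dm) * 1" using assms kp mp by (intro mult_left_mono) auto
  then show ?thesis using km mm by simp
qed

lemma denom_side:
  assumes "v \<le> 1" shows "0 < K - dk * v"
proof -
  have "dk * v \<le> dk * 1" using assms kp by (intro mult_left_mono) auto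
  then show ?thesis using km mm mp by simp
qed

lemma beyond_iff: "beyond v \<longleftrightarrow> K * s / (dk * (t + s)) < v"
proof -
  have "0 < dk * (t + s)" using kp ts_pos by simp
  then show ?thesis unfolding beyond_def by (simp add: pos_divide_less_eq algebra_simps)
qed

lemma beyond_t_pos:
  assumes "beyond v" "v \<le> 1" shows "0 < t"
proof (rule ccontr)
  assume "\<not> 0 < t"
  then have "t = 0" using t by simp
  moreover have "0 \<le> (K - dk * v) * s" using denom_side[OF assms(2)] s by simp
  ultimately show False using assms(1) unfolding beyond_def by simp
qed

section \<open>Strict monotonicity of the interior and side formulas\<close>

lemma interior_strict_mono:
  assumes "v < w" "w \<le> 1" shows "interior v < interior w"
proof -
  define c P Q R where "c = dk + dm" and "P = dk * t\<^sup>2 + dm * s\<^sup>2"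
    and "Q = (dk * t - dm * s)\<^sup>2" and "R = dk * dm * (t + s)\<^sup>2"
  define x y where "x = K - c * v" and "y = K - c * w"
  have x: "0 < x" and y: "0 < y"
    using denom_int[of v] denom_int[of w] assms by (auto simp: x_def y_def c_def)
  have c: "0 < c" "0 < K - c" "0 < K" using km kp mm mp by (auto simp: c_def)
  have R: "0 < R" using kp mp ts_pos by (simp add: R_def)
  have Q: "0 \<le> Q" by (simp add: Q_def)
  have cP: "c * P = Q + R"
  proof -
    have "c * P = dk\<^sup>2 * t\<^sup>2 + dm\<^sup>2 * s\<^sup>2 + dk * dm * (t\<^sup>2 + s\<^sup>2)"
      unfolding c_def P_def by algebra
    also have "\<dots> = Q + R" unfolding Q_def R_def by algebra
    finally show ?thesis .
  qed
  \<comment> \<open>The share \<open>Q\<close> of \<open>c * P\<close> cancels the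
    \<open>x * y\<close> term of the fractional part. Both remaining terms have a sign, since
    \<open>R > 0\<close> and \<open>K - c = km + mm\<close>.\<close>
  have key: "(interior w - interior v) * (c * x * y) = (w - v) * (R * x * y + Q * K * (K - c))"
  proof -
    have "interior w - interior v = (w - v) * P - (w * (1 - w) * Q / y - v * (1 - v) * Q / x)"
      unfolding interior_def P_def[symmetric] Q_def[symmetric] c_def[symmetric]
        x_def[symmetric] y_def[symmetric] by (simp add: left_diff_distrib)
    moreover have "((w - v) * P - (A / y - B / x)) * (c * x * y)
        = (w - v) * (c * P) * x * y - c * (A * x - B * y)" for A B
      using x y by (simp add: field_simps)
    ultimately have "(interior w - interior v) * (c * x * y)
        = (w - v) * (c * P) * x * y - c * (w * (1 - w) * Q * x - v * (1 - v) * Q * y)"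
      by simp
    also have "c * (w * (1 - w) * Q * x - v * (1 - v) * Q * y) = Q * (w - v) * (x * y - K * (K - c))"
      unfolding x_def y_def by algebra
    finally show ?thesis unfolding cP by algebra
  qed
  have "0 < (w - v) * (R * x * y + Q * K * (K - c))"
    using assms R Q x y c by (intro mult_pos_pos add_pos_nonneg) auto
  then have "0 < (interior w - interior v) * (c * x * y)" by (simp only: key)
  moreover have "0 < c * x * y" using x y c by simp
  ultimately have "0 < interior w - interior v" by (simp only: zero_less_mult_pos2)
  then show ?thesis by simp
qed

lemma side_strict_mono:
  assumes "0 < t" "v < w" "w \<le> 1" shows "side v < side w"
proof -
  have "dk * v < dk * w" using assms kp by simp
  then show ?thesis unfolding side_def
    using denom_side[of v] denom_side[of w] assms km kp mm mp
    by (intro add_strict_left_mono divide_strict_left_mono mult_pos_pos) auto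
qed

section \<open>Comparison of the side and interior formulas\<close>

lemma side_eq:
  assumes "v \<le> 1"
  shows "side v = km * t\<^sup>2 + mm * s\<^sup>2 + v * (dk * t\<^sup>2 + dm * s\<^sup>2)
    - (1 - v) * (v * t\<^sup>2 * dk\<^sup>2 / (K - dk * v) - s\<^sup>2 * dm)"
proof -
  define x where "x = K - dk * v"
  have "0 < x" using denom_side[OF assms] by (simp add: x_def)
  then have "(side v - (km * t\<^sup>2 + mm * s\<^sup>2 + v * (dk * t\<^sup>2 + dm * s\<^sup>2)
      - (1 - v) * (v * t\<^sup>2 * dk\<^sup>2 / x - s\<^sup>2 * dm))) * x
    = (mp * (s\<^sup>2 - t\<^sup>2)) * x + t\<^sup>2 * K * (km + mp)
      - (km * t\<^sup>2 + mm * s\<^sup>2 + v * (dk * t\<^sup>2 + dm * s\<^sup>2)) * x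
      + (1 - v) * (v * t\<^sup>2 * dk\<^sup>2 - s\<^sup>2 * dm * x)"
    unfolding side_def x_def[symmetric] by (simp add: field_simps)
  also have "\<dots> = 0" unfolding x_def by algebra
  finally show ?thesis using \<open>0 < x\<close> by (simp add: x_def)
qed

lemma side_minus_interior:
  assumes "v \<le> 1"
  shows "side v - interior v = (1 - v) * dm * ((K - dk * v) * s - v * t * dk)\<^sup>2
    / ((K - (dk + dm) * v) * (K - dk * v))"
proof -
  define x y where "x = K - dk * v" and "y = K - (dk + dm) * v"
  have xy: "0 < x" "0 < y" using denom_side[OF assms] denom_int[OF assms]
    by (auto simp: x_def y_def)
  have "side v - interior v
    = (1 - v) * (v * (dk * t - dm * s)\<^sup>2 / y - v * t\<^sup>2 * dk\<^sup>2 / x + s\<^sup>2 * dm)"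
    unfolding side_eq[OF assms] interior_def x_def[symmetric] y_def[symmetric]
    by (simp add: algebra_simps)
  also have "\<dots> = (1 - v) * (v * (dk * t - dm * s)\<^sup>2 * x - v * t\<^sup>2 * dk\<^sup>2 * y + s\<^sup>2 * dm * x * y) / (y * x)"
    using xy by (simp add: field_simps)
  also have "v * (dk * t - dm * s)\<^sup>2 * x - v * t\<^sup>2 * dk\<^sup>2 * y + s\<^sup>2 * dm * x * y
    = dm * (x * s - v * t * dk)\<^sup>2"
    unfolding x_def y_def by algebra
  finally show ?thesis by (simp add: x_def y_def mult.assoc)
qed

lemma interior_le_side:
  assumes "v \<le> 1" shows "interior v \<le> side v"
proof -
  have "0 \<le> side v - interior v"
    unfolding side_minus_interior[OF assms]
    using denom_side[OF assms] denom_int[OF assms] assms mp by simp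
  then show ?thesis by simp
qed

text \<open>This \<open>v\<close> is the zero of the square in
  \<open>side_minus_interior\<close>.\<close>

lemma interior_eq_side:
  assumes "v \<le> 1" "v = K * s / (dk * (t + s))" shows "interior v = side v"
proof -
  have "(K - dk * v) * s - v * t * dk = K * s - v * (dk * (t + s))"
    by (simp add: algebra_simps)
  also have "\<dots> = 0" using assms(2) ts_pos kp by simp
  finally show ?thesis using side_minus_interior[OF assms(1)] by simp
qed

section \<open>Inversion of the side formula\<close>

lemma side_vhat2:
  assumes "vhat2 km kp mm mp e t \<le> 1" "0 < t"
  shows "side (vhat2 km kp mm mp e t) = e"
proof -
  define d where "d = e - mp * (1 - 2 * t\<^sup>2)"
  define v where "v = vhat2 km kp mm mp e t"
  have v: "v = K / dk * (1 - t\<^sup>2 * (km + mp) / d)" by (simp add: v_def vhat2_def d_def)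
  \<comment> \<open>If \<open>d = 0\<close>, division by zero would give
    \<open>v = K / dk > 1\<close>, against the first hypothesis.\<close>
  have "1 < K / dk" using km kp mm mp by simp
  then have d: "d \<noteq> 0" using v assms(1) by (auto simp: v_def[symmetric])
  have "dk * v = K * (1 - t\<^sup>2 * (km + mp) / d)" using kp unfolding v by simp
  then have x: "K - dk * v = K * t\<^sup>2 * (km + mp) / d" by (simp add: algebra_simps)
  have "K * t\<^sup>2 * (km + mp) \<noteq> 0" using km kp mm mp assms(2) by simp
  then have "t\<^sup>2 * K * (km + mp) / (K - dk * v) = d" unfolding x using d by (simp add: mult_ac)
  moreover have "s\<^sup>2 - t\<^sup>2 = 1 - 2 * t\<^sup>2" using circle by simp
  ultimately show ?thesis by (simp add: side_def d_def v_def[symmetric])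
qed

text \<open>The inverse of \<open>side\<close> is explicit and order preserving where
  \<open>d > 0\<close>, so bounds on the level \<open>e\<close> become bounds on the
  argument.\<close>

lemma vhat2_between:
  assumes t: "0 < t" and u: "u < v" "v \<le> 1" and e: "side u < e" "e \<le> side v"
  shows "u < vhat2 km kp mm mp e t" "vhat2 km kp mm mp e t \<le> v"
proof -
  define d where "d = e - mp * (1 - 2 * t\<^sup>2)"
  define w where "w = vhat2 km kp mm mp e t"
  define C where "C = t\<^sup>2 * K * (km + mp)"
  have x: "0 < K - dk * u" "0 < K - dk * v" using denom_side u by auto
  have C: "0 < C" using km kp mm mp t by (simp add: C_def)
  have st: "s\<^sup>2 - t\<^sup>2 = 1 - 2 * t\<^sup>2" using circle by simp
  have du: "C / (K - dk * u) < d" and dv: "d \<le> C / (K - dk * v)"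
    using e by (auto simp: side_def d_def C_def st)
  \<comment> \<open>The strict lower bound on \<open>e\<close> fixes the sign of \<open>d\<close>;
    both inequalities can then be inverted.\<close>
  have d: "0 < d" using du C x(1) by (meson divide_pos_pos less_trans)
  have "w = K / dk * (1 - t\<^sup>2 * (km + mp) / d)" by (simp add: w_def vhat2_def d_def)
  then have "dk * w = K * (1 - t\<^sup>2 * (km + mp) / d)" using kp by simp
  then have wx: "dk * w = K - C / d" by (simp add: C_def right_diff_distrib mult_ac)
  have "C / d < K - dk * u" using du d x by (simp add: field_simps)
  then have "dk * u < dk * w" by (simp add: wx)
  then show "u < vhat2 km kp mm mp e t" using kp by (simp add: w_def)
  have "K - dk * v \<le> C / d" using dv d x by (simp add: field_simps)
  then have "dk * w \<le> dk * v" by (simp add: wx)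
  then show "vhat2 km kp mm mp e t \<le> v" using kp by (simp add: w_def)
qed

section \<open>The quadratic equation behind \<open>vhat1\<close>\<close>

lemma vhat1_root:
  assumes "km * t\<^sup>2 + mm * s\<^sup>2 \<le> e" "e \<le> kp * t\<^sup>2 + mp * s\<^sup>2"
  defines "v \<equiv> vhat1 km kp mm mp e t"
  shows "0 \<le> v" "v \<le> 1" "interior v = e"
proof -
  \<comment> \<open>\<open>R\<close>, \<open>B\<close> and \<open>C\<close> are the coefficients of
    the quadratic \<open>p\<close> obtained from \<open>interior x = e\<close> by clearing the
    denominator; \<open>vhat_D\<close> is its discriminant.\<close>
  define R where "R = dk * dm * (t + s)\<^sup>2"
  define B where "B = e * (dm + dk) + (t\<^sup>2 - s\<^sup>2) * (dk * mp - dm * kp) + R"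
  define C where "C = K * (e - (km * t\<^sup>2 + mm * s\<^sup>2))"
  define D where "D = vhat_D km kp mm mp e t"
  define p where "p x = R * x\<^sup>2 - B * x + C" for x
  have R: "0 < R" using kp mp ts_pos by (simp add: R_def)
  have C: "0 \<le> C" using assms(1) km kp mm mp by (simp add: C_def)
  \<comment> \<open>Homogenizing in \<open>t\<close> and \<open>s\<close> turns the identities below
    into purely polynomial ones.\<close>
  have hom: "1 - 2 * t\<^sup>2 = s\<^sup>2 - t\<^sup>2" "2 * t\<^sup>2 - 1 = t\<^sup>2 - s\<^sup>2" "t\<^sup>2 - 1 = - s\<^sup>2"
    using circle by auto
  have D: "D = B\<^sup>2 - 4 * R * C"
    unfolding D_def vhat_D_def B_def C_def R_def Let_def sqrt_t hom by algebra
  have v: "v = (B - sqrt D) / (2 * R)"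
  proof -
    have "v = 1 / 2 + (B - R - sqrt D) / (2 * R)"
      unfolding v_def vhat1_def D_def B_def R_def Let_def sqrt_t hom by (simp add: mult.assoc)
    also have "\<dots> = (B - sqrt D) / (2 * R)" using R by (simp add: field_simps)
    finally show ?thesis .
  qed
  have p_int: "p x = (K - (dk + dm) * x) * (e - interior x)" if "x \<le> 1" for x
  proof -
    define y where "y = K - (dk + dm) * x"
    have "0 < y" using denom_int[OF that] by (simp add: y_def)
    then have "y * (e - (A - N / y)) = y * (e - A) + N" for A N by (simp add: field_simps)
    then have "y * (e - interior x) = y * (e - (km * t\<^sup>2 + mm * s\<^sup>2 + x * (dk * t\<^sup>2 + dm * s\<^sup>2)))
      + x * (1 - x) * (dk * t - dm * s)\<^sup>2"
      unfolding interior_def y_def[symmetric] .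
    also have "\<dots> = p x" unfolding p_def B_def C_def R_def y_def by algebra
    finally show ?thesis by (simp add: y_def)
  qed
  have "interior 1 = kp * t\<^sup>2 + mp * s\<^sup>2" by (simp add: interior_def left_diff_distrib)
  moreover have "K - (dk + dm) * 1 = km + mm" by simp
  ultimately have "p 1 = (km + mm) * (e - (kp * t\<^sup>2 + mp * s\<^sup>2))" using p_int[of 1] by simp
  then have p1: "p 1 \<le> 0" using assms(2) km mm by (simp add: mult_nonneg_nonpos)
  \<comment> \<open>Completing the square at \<open>1\<close>: with \<open>p 1 \<le> 0\<close> this
    gives both that the roots are real and that the smaller one is at most \<open>1\<close>.\<close>
  have sq: "(2 * R - B)\<^sup>2 = D + 4 * R * p 1"
    unfolding D p_def by (simp add: power2_eq_square algebra_simps)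
  have "4 * R * p 1 \<le> 0" using R p1 by (simp add: mult_nonneg_nonpos)
  then have "(2 * R - B)\<^sup>2 \<le> D" using sq by simp
  then have le: "\<bar>2 * R - B\<bar> \<le> sqrt D" by (metis real_sqrt_abs real_sqrt_le_iff)
  have D0: "0 \<le> D" using \<open>(2 * R - B)\<^sup>2 \<le> D\<close> by (meson order_trans zero_le_power2)
  show v1: "v \<le> 1" unfolding v using le R by (simp add: pos_divide_le_eq)
  \<comment> \<open>\<open>p 1 \<le> 0\<close> reads \<open>R + C \<le> B\<close>.\<close>
  have "B \<ge> 0" using p1 C R by (simp add: p_def)
  moreover have "D \<le> B\<^sup>2" using D R C by simp
  ultimately have "sqrt D \<le> B" by (simp add: real_le_lsqrt D0)
  then show "0 \<le> v" unfolding v using R by simp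
  have "2 * R * v = B - sqrt D" using R by (simp add: v)
  then have "(2 * R * v - B)\<^sup>2 = D" using D0 by (simp add: power2_eq_square)
  then have "4 * R * p v = 0" unfolding D p_def by (simp add: power2_eq_square algebra_simps)
  then have "p v = 0" using R by simp
  then show "interior v = e" using p_int[OF v1] denom_int[OF v1] by simp
qed

section \<open>The full bound and its monotonicity\<close>

lemma interior_swap: "hs_data.interior mm mp km kp s t v = interior v"
  unfolding interior_def hs_data.interior_def[OF swap]
  unfolding power2_commute[of "dm * s"] add.commute[of mp kp] add.commute[of dm dk]
    add.commute[of "dm * s\<^sup>2"] add.commute[of "mm * s\<^sup>2"] ..

abbreviation "beyond' \<equiv> hs_data.beyond mm mp kp s t"
abbreviation "side' \<equiv> hs_data.side mm mp kp s t"

text \<open>The sum of the two inequalities, divided by \<open>t + s\<close>, would make the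
  interior denominator negative.\<close>

lemma not_both_beyond:
  assumes "v \<le> 1" "beyond v" shows "\<not> beyond' v"
proof
  assume "beyond' v"
  with assms(2) have "K * (t + s) < v * (dk + dm) * (t + s)"
    by (simp add: beyond_def hs_data.beyond_def[OF swap] algebra_simps)
  then have "K < v * (dk + dm)" using ts_pos by simp
  then show False using denom_int[OF assms(1)] by (simp add: mult.commute)
qed

text \<open>\<open>f_HS\<close> in terms of \<open>t\<close> and \<open>s\<close>;
  \<open>bound_hs_q\<close> links it to \<open>hs_q\<close>.\<close>

definition bound :: "real \<Rightarrow> real" where
  "bound v = (if beyond v then side v else if beyond' v then side' v else interior v)"

lemma interior_le_bound:
  assumes "v \<le> 1" shows "interior v \<le> bound v"
  using interior_le_side[OF assms] hs_data.interior_le_side[OF swap assms]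
  by (simp add: bound_def interior_swap)

lemma beyond_upward: "beyond v \<Longrightarrow> v \<le> w \<Longrightarrow> beyond w"
  by (auto simp: beyond_iff)

text \<open>Side regimes are closed upwards, so \<open>w\<close> shares a side regime of
  \<open>v\<close>. From the interior regime, \<open>interior v < interior w \<le> bound w\<close>
  holds in whichever regime \<open>w\<close> lies, which settles boundary crossings without
  continuity.\<close>

lemma bound_strict_mono:
  assumes "v < w" "w \<le> 1" shows "bound v < bound w"
proof -
  interpret sw: hs_data mm mp km kp s t by (rule swap)
  consider "beyond v" | "beyond' v" | "\<not> beyond v" "\<not> beyond' v" by blast
  then show ?thesis
  proof cases
    case 1
    then have "beyond w" using beyond_upward assms by simp
    then show ?thesis
      using 1 side_strict_mono[of v w] beyond_t_pos[of v] assms by (simp add: bound_def)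
  next
    case 2
    then have "beyond' w" using sw.beyond_upward assms by simp
    then have "\<not> beyond w" "\<not> beyond v" using 2 not_both_beyond assms by fastforce+
    then show ?thesis
      using 2 \<open>beyond' w\<close> sw.side_strict_mono[of v w] sw.beyond_t_pos[of v] assms
      by (simp add: bound_def)
  next
    case 3
    then show ?thesis
      using interior_strict_mono[of v w] interior_le_bound[of w] assms by (simp add: bound_def)
  qed
qed

lemma bound_hs_q:
  assumes "v \<le> 1"
  shows "bound v = km * t\<^sup>2 + mm * s\<^sup>2 + v * (dk * t\<^sup>2 + dm * s\<^sup>2) - hs_q km kp mm mp t v"
proof -
  have s2: "1 - t\<^sup>2 = s\<^sup>2" using circle by simp
  have "hs_q km kp mm mp t v =
    (if beyond v then (1 - v) * (v * t\<^sup>2 * dk\<^sup>2 / (K - dk * v) - s\<^sup>2 * dm)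
     else if beyond' v then (1 - v) * (v * dm\<^sup>2 * s\<^sup>2 / (K - dm * v) - t\<^sup>2 * dk)
     else v * (1 - v) * (dk * t - dm * s)\<^sup>2 / (K - (dk + dm) * v))"
    unfolding hs_q_def Let_def sqrt_t
    unfolding s2 beyond_def hs_data.beyond_def[OF swap]
    by (auto simp: mult_ac add.commute[of mp kp])
  then show ?thesis
    using side_eq[OF assms] hs_data.side_eq[OF swap assms]
    by (auto simp: bound_def interior_def algebra_simps)
qed

section \<open>Case conditions as regime conditions\<close>

lemma vhat_case1_iff:
  "vhat_case1 km kp mm mp e t \<longleftrightarrow>
    \<not> beyond (vhat1 km kp mm mp e t) \<and> \<not> beyond' (vhat1 km kp mm mp e t)"
proof -
  have "x \<le> K / (t + s) * min (s / dk) (t / dm) \<longleftrightarrow>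
      x \<le> K * s / (dk * (t + s)) \<and> x \<le> K * t / (dm * (t + s))" for x
  proof -
    have "K / (t + s) * min (s / dk) (t / dm) = min (K / (t + s) * (s / dk)) (K / (t + s) * (t / dm))"
      using km kp mm mp ts_pos by (simp add: min_mult_distrib_left)
    then show ?thesis by (simp add: mult.commute)
  qed
  then show ?thesis
    unfolding vhat_case1_def Let_def sqrt_t beyond_iff hs_data.beyond_iff[OF swap]
    by (auto simp: not_less add.commute)
qed

lemma vhat_case2_iff:
  "vhat_case2 km kp mm mp e t \<longleftrightarrow>
    beyond (vhat2 km kp mm mp e t) \<and> vhat2 km kp mm mp e t \<le> 1"
  by (simp add: vhat_case2_def sqrt_t beyond_iff)

lemma vhat3_swap: "vhat3 km kp mm mp e t = vhat2 mm mp km kp e s"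
proof -
  have "1 - t\<^sup>2 = s\<^sup>2" "e + kp * (1 - 2 * t\<^sup>2) = e - kp * (1 - 2 * s\<^sup>2)"
    using circle by algebra+
  then show ?thesis unfolding vhat3_def vhat2_def by (simp only: add.commute)
qed

lemma vhat_case3_iff:
  "vhat_case3 km kp mm mp e t \<longleftrightarrow>
    beyond' (vhat3 km kp mm mp e t) \<and> vhat3 km kp mm mp e t \<le> 1"
  by (simp add: vhat_case3_def sqrt_t hs_data.beyond_iff[OF swap] add.commute)

lemma beyond_nonneg:
  assumes "beyond v" shows "0 \<le> v"
proof -
  have "0 \<le> K * s / (dk * (t + s))" using km kp mm mp s ts_pos by simp
  then show ?thesis using assms by (simp add: beyond_iff)
qed

lemma bound_vhat2:
  assumes "beyond (vhat2 km kp mm mp e t)" "vhat2 km kp mm mp e t \<le> 1"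
  shows "bound (vhat2 km kp mm mp e t) = e"
  using side_vhat2[OF assms(2) beyond_t_pos[OF assms]] assms(1) by (simp add: bound_def)

text \<open>Meant for \<open>v = vhat1\<close>. At the boundary \<open>u\<close> the formulas agree,
  so \<open>side u = interior u < interior v = e \<le> side v\<close>, and
  \<open>vhat2_between\<close> applies.\<close>

lemma beyond_vhat2:
  assumes "beyond v" "v \<le> 1" "interior v = e"
  shows "beyond (vhat2 km kp mm mp e t)" "vhat2 km kp mm mp e t \<le> 1"
proof -
  define u where "u = K * s / (dk * (t + s))"
  have u: "u < v" using assms(1) by (simp add: u_def beyond_iff)
  have "side u < e"
    using interior_strict_mono[of u v] interior_eq_side[of u] u assms by (simp add: u_def)
  moreover have "e \<le> side v" using interior_le_side assms by auto
  ultimately show "beyond (vhat2 km kp mm mp e t)" "vhat2 km kp mm mp e t \<le> 1"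
    using vhat2_between[OF beyond_t_pos[OF assms(1,2)] u assms(2), of e] assms(2)
    by (auto simp: beyond_iff u_def[symmetric])
qed

text \<open>Each case condition makes its candidate a solution, and uniqueness identifies all
  candidates whose conditions hold.\<close>

lemma bound_solution:
  assumes e: "km * t\<^sup>2 + mm * s\<^sup>2 \<le> e" "e \<le> kp * t\<^sup>2 + mp * s\<^sup>2"
  obtains v where "0 \<le> v" "v \<le> 1" "bound v = e"
    "vhat_case1 km kp mm mp e t \<Longrightarrow> v = vhat1 km kp mm mp e t"
    "vhat_case2 km kp mm mp e t \<Longrightarrow> v = vhat2 km kp mm mp e t"
    "vhat_case3 km kp mm mp e t \<Longrightarrow> v = vhat3 km kp mm mp e t"
    "vhat_case1 km kp mm mp e t \<or> vhat_case2 km kp mm mp e t \<or> vhat_case3 km kp mm mp e t"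
proof -
  interpret sw: hs_data mm mp km kp s t by (rule swap)
  define sol where "sol v \<longleftrightarrow> 0 \<le> v \<and> v \<le> 1 \<and> bound v = e" for v
  note root = vhat1_root[OF e]
  have uniq: "v = w" if "sol v" "sol w" for v w
    using that bound_strict_mono[of v w] bound_strict_mono[of w v]
    by (cases v w rule: linorder_cases) (auto simp: sol_def)
  have 1: "sol (vhat1 km kp mm mp e t)" if "vhat_case1 km kp mm mp e t"
    using that root by (simp add: sol_def vhat_case1_iff bound_def)
  have 2: "sol (vhat2 km kp mm mp e t)" if "vhat_case2 km kp mm mp e t"
    using that bound_vhat2 beyond_nonneg by (simp add: sol_def vhat_case2_iff)
  \<comment> \<open>The swapped bound tests the side regimes in the opposite order; they exclude
    each other.\<close>
  have bound_swap: "sw.bound v = bound v" if "v \<le> 1" for v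
    using not_both_beyond[OF that]
    by (auto simp: bound_def sw.bound_def interior_swap)
  have 3: "sol (vhat3 km kp mm mp e t)" if "vhat_case3 km kp mm mp e t"
    using that sw.bound_vhat2 sw.beyond_nonneg bound_swap
    by (simp add: sol_def vhat_case3_iff vhat3_swap)
  \<comment> \<open>If case 1 fails, \<open>vhat1\<close> lies beyond a boundary, and
    \<open>beyond_vhat2\<close>, plain or swapped, gives case 2 or 3.\<close>
  have some: "vhat_case1 km kp mm mp e t \<or> vhat_case2 km kp mm mp e t \<or> vhat_case3 km kp mm mp e t"
    using beyond_vhat2[of "vhat1 km kp mm mp e t" e] sw.beyond_vhat2[of "vhat1 km kp mm mp e t" e] root
    by (auto simp: vhat_case1_iff vhat_case2_iff vhat_case3_iff vhat3_swap interior_swap)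
  then obtain v where "sol v" using 1 2 3 by blast
  then show thesis using that[of v] 1 2 3 some uniq[OF \<open>sol v\<close>] \<open>sol v\<close>[unfolded sol_def] by blast
qed

end

section \<open>The Frobenius inner product\<close>

lemma mat_1_inner: "(mat 1 :: real^2^2) \<bullet> A = trace A"
  by (simp add: inner_vec_def trace_def mat_def sum_2)

lemma trace_mat_1: "trace (mat 1 :: real^2^2) = 2"
  by (simp add: trace_def mat_def)

lemma iso_tensor_inner:
  "iso_tensor \<kappa> \<mu> A \<bullet> A = \<kappa> * (trace A)\<^sup>2 + 2 * \<mu> * ((norm A)\<^sup>2 - (trace A)\<^sup>2 / 2)"
  by (simp add: iso_tensor_def inner_left_distrib inner_diff_left mat_1_inner
      dot_square_norm power2_eq_square)

text \<open>Cauchy-Schwarz against the identity matrix, whose squared norm is 2. It yields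
  \<open>t \<le> 1\<close> for the given strain.\<close>

lemma trace_squared_le: "(trace (A :: real^2^2))\<^sup>2 \<le> 2 * (norm A)\<^sup>2"
  using Cauchy_Schwarz_ineq[of "mat 1" A]
  by (simp add: mat_1_inner trace_mat_1 power2_norm_eq_inner)

theorem proposition3p5:
  fixes km kp mm mp e t :: real
    and E :: "real^2^2 \<Rightarrow> real^2^2"
    and \<epsilon> :: "real^2^2"
  assumes "0 < km" "km < kp" "0 < mm" "mm < mp"
    and "elasticity_tensor E"
    and "loewner_le (iso_tensor km mm) E"
    and "loewner_le E (iso_tensor kp mp)"
    and "\<epsilon> \<in> sym_mats"
    and "norm \<epsilon> = sqrt 2 / 2"
    and "e = E \<epsilon> \<bullet> \<epsilon>"
    and "t = \<bar>trace \<epsilon>\<bar>"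
  shows "\<exists>v. v \<in> hs_active_set km kp mm mp E \<epsilon> \<and>
             (\<forall>w \<in> hs_active_set km kp mm mp E \<epsilon>. v \<le> w) \<and>
             (vhat_case1 km kp mm mp e t \<longrightarrow> v = vhat1 km kp mm mp e t) \<and>
             (vhat_case2 km kp mm mp e t \<longrightarrow> v = vhat2 km kp mm mp e t) \<and>
             (vhat_case3 km kp mm mp e t \<longrightarrow> v = vhat3 km kp mm mp e t) \<and>
             (vhat_case1 km kp mm mp e t \<or> vhat_case2 km kp mm mp e t \<or> vhat_case3 km kp mm mp e t)"
proof -
  define s where "s = sqrt (1 - t\<^sup>2)"
  have norm: "(norm \<epsilon>)\<^sup>2 = 1 / 2" unfolding assms(9) by (simp add: power_divide)
  have tr: "(trace \<epsilon>)\<^sup>2 = t\<^sup>2" by (simp add: assms(11))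
  have "t\<^sup>2 \<le> 1" using trace_squared_le[of \<epsilon>] by (simp add: norm tr)
  then have s2: "s\<^sup>2 = 1 - t\<^sup>2" by (simp add: s_def)
  interpret hs_data km kp mm mp t s
    using assms(1-4,11) \<open>t\<^sup>2 \<le> 1\<close> by unfold_locales (auto simp: s_def)
  \<comment> \<open>The normalization of the strain gives its deviatoric part the squared norm
    \<open>s\<^sup>2 / 2\<close>, which absorbs the factor 2 of the shear term.\<close>
  have iso: "iso_tensor \<kappa> \<mu> \<epsilon> \<bullet> \<epsilon> = \<kappa> * t\<^sup>2 + \<mu> * s\<^sup>2" for \<kappa> \<mu>
    by (simp add: iso_tensor_inner norm tr s2 algebra_simps)
  \<comment> \<open>The Loewner bounds tested on the strain place \<open>e\<close> between the
    energies of the pure phases.\<close>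
  have e: "km * t\<^sup>2 + mm * s\<^sup>2 \<le> e" "e \<le> kp * t\<^sup>2 + mp * s\<^sup>2"
    using assms(6-8,10) by (auto simp: loewner_le_def iso[symmetric])
  have f: "f_HS km kp mm mp \<epsilon> v = bound v" if "v \<le> 1" for v
    using bound_hs_q[OF that]
    by (simp add: f_HS_def inner_left_distrib iso assms(11)[symmetric] algebra_simps)
  have active: "hs_active_set km kp mm mp E \<epsilon> = {v. 0 \<le> v \<and> v \<le> 1 \<and> bound v = e}"
    using f by (auto simp: hs_active_set_def assms(10))
  from bound_solution[OF e] obtain v where v: "0 \<le> v" "v \<le> 1" "bound v = e"
    "vhat_case1 km kp mm mp e t \<Longrightarrow> v = vhat1 km kp mm mp e t"
    "vhat_case2 km kp mm mp e t \<Longrightarrow> v = vhat2 km kp mm mp e t"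
    "vhat_case3 km kp mm mp e t \<Longrightarrow> v = vhat3 km kp mm mp e t"
    "vhat_case1 km kp mm mp e t \<or> vhat_case2 km kp mm mp e t \<or> vhat_case3 km kp mm mp e t"
    by blast
  have "v \<le> w" if "bound w = e" for w
    using bound_strict_mono[of w v] that v(2,3) by force
  then have "\<forall>w \<in> hs_active_set km kp mm mp E \<epsilon>. v \<le> w" by (auto simp: active)
  moreover have "v \<in> hs_active_set km kp mm mp E \<epsilon>" using v(1-3) by (simp add: active)
  ultimately show ?thesis using v(4-7) by blast
qed

end
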